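(* Let $X$ be an alphabet. (1) For every finite-dimensional linear weighted automaton $\mathcal{A}$ over a real vector space (with alphabet $X$) there exists a weighted finite automaton $\mathcal{A}'$ over $\mathbb{R}$ and $X$ which is completely language-equivalent to $\mathcal{A}$, i.e. $[\![\mathcal{A}']\!](u)=[\![\mathcal{A}]\!](u)$ and $[\![\mathcal{A}']\!]_g(u)=[\![\mathcal{A}]\!]_g(u)$ for every $u\in X^*$. (2) Conversely, for every weighted finite automaton $\mathcal{A}$ over $\mathbb{R}$ and $X$ there exists a finite-dimensional linear weighted automaton $\mathcal{B}$ over a real vector space (with alphabet $X$) which is completely language-equivalent to $\mathcal{A}$, i.e. $[\![\mathcal{B}]\!](u)=[\![\mathcal{A}]\!](u)$ and $[\![\mathcal{B}]\!]_g(u)=[\![\mathcal{A}]\!]_g(u)$ for every $u\in X^*$.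
   Context: $X^*$ denotes the set of all words over $X$, with empty word $\varepsilon$. On $\mathbb{R}^n$ ($n\in\mathbb{N}$, $n\ge 1$), $\|\alpha\|_\infty=\max_{1\le i\le n}|\alpha_i|$. Weighted finite automata. A weighted finite automaton over $\mathbb{R}$ and $X$ with $n\geq 1$ states is given by its linear representation $\mathcal{A}=(n,\sigma,\{M_x\}_{x\in X},\tau)$, where $\sigma\in\mathbb{R}^n$ (initial weights, treated as a row vector), $\tau\in\mathbb{R}^n$ (terminal weights, treated as a column vector), and $M_x\in\mathbb{R}^{n\times n}$ (transition weights matrices). For $u=x_1x_2\cdots x_k$ put $M_u=M_{x_1}M_{x_2}\cdots M_{x_k}$, with $M_\varepsilon=I_n$, and $\sigma_u=\sigma\cdot M_u$. Its behavior (the function it computes) is $[\![\mathcal{A}]\!](u)=\sigma\cdot M_u\cdot\tau$, and the function it generates is $[\![\mathcal{A}]\!]_g(u)=\|\sigma_u\|_\infty$, for every $u\in X^*$. Weighted automata over a vector space. A weighted automaton over a real vector space $V$ is a tuple $\mathcal{A}=(S,\sigma,\delta,\Theta)$, where $S\subseteq V$ is a non-empty (possibly infinite) set of vector states, $\sigma\in S$ is the initial vector state, $\delta:S\times X\to S$ is the transition function, and $\Theta:S\to\mathbb{R}$ is the terminal weights function. Write $\delta_x(\alpha)=\delta(\alpha,x)$, and extend $\delta$ to $\delta^*:S\times X^*\to S$ by $\delta^*(\alpha,\varepsilon)=\alpha$ and $\delta^*(\alpha,ux)=\delta(\delta^*(\alpha,u),x)$. Its behavior is $[\![\mathcal{A}]\!](u)=\Theta(\delta^*(\sigma,u))$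 and the function it generates is $[\![\mathcal{A}]\!]_g(u)=\|\delta^*(\sigma,u)\|$, where $\|\cdot\|$ is a norm on $V$. $\mathcal{A}$ is finite-dimensional (of dimension $n$) if $V$ is isomorphic to $\mathbb{R}^n$ for some $n\in\mathbb{N}$, $n\ge1$. In that case $V$ is identified with $\mathbb{R}^n$ through a fixed linear isomorphism, and the norm used in $[\![\mathcal{A}]\!]_g$ is the maximum norm $\|\cdot\|_\infty$ on $\mathbb{R}^n$. $\mathcal{A}$ is linear if for every $x\in X$ the function $\delta_x$ is the restriction to $S$ of some linear operator $\delta_x':\mathrm{span}(S)\to\mathrm{span}(S)$, and $\Theta$ is the restriction to $S$ of some linear functional $\Theta':\mathrm{span}(S)\to\mathbb{R}$. *)

theory Defs
  imports "Jordan_Normal_Form.VS_Connect"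
begin

section \<open>Weighted finite automata\<close>

definition max_norm :: "real vec \<Rightarrow> real" where
  "max_norm v = Max ((\<lambda>i. \<bar>v $ i\<bar>) ` {..<dim_vec v})"

record 'x wfa =
  wfa_dim :: nat
  wfa_init :: "real vec"
  wfa_trans :: "'x \<Rightarrow> real mat"
  wfa_final :: "real vec"

definition is_wfa :: "'x set \<Rightarrow> 'x wfa \<Rightarrow> bool" where
  "is_wfa X A \<longleftrightarrow>
     wfa_dim A \<ge> 1 \<and>
     wfa_init A \<in> carrier_vec (wfa_dim A) \<and>
     (\<forall>x\<in>X. wfa_trans A x \<in> carrier_mat (wfa_dim A) (wfa_dim A)) \<and>
     wfa_final A \<in> carrier_vec (wfa_dim A)"

definition wfa_mat :: "'x wfa \<Rightarrow> 'x list \<Rightarrow> real mat" where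
  "wfa_mat A u = foldr (\<lambda>x P. wfa_trans A x * P) u (1\<^sub>m (wfa_dim A))"

text \<open>The vector obtained by multiplying the initial weights, as a row vector, by the
  matrix of the word \<open>u\<close> from the right.\<close>

definition wfa_vec :: "'x wfa \<Rightarrow> 'x list \<Rightarrow> real vec" where
  "wfa_vec A u = row (mat_of_row (wfa_init A) * wfa_mat A u) 0"

definition wfa_behavior :: "'x wfa \<Rightarrow> 'x list \<Rightarrow> real" where
  "wfa_behavior A u = wfa_vec A u \<bullet> wfa_final A"

definition wfa_generated :: "'x wfa \<Rightarrow> 'x list \<Rightarrow> real" where
  "wfa_generated A u = max_norm (wfa_vec A u)"


section \<open>Weighted automata over a real vector space\<close>

text \<open>Real vector spaces are carrier-based (\<open>vectorspace class_ring V\<close>), so that spaces of every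
  finite dimension can be quantified over inside a formula.\<close>

record ('v, 'x) wva =
  wva_states :: "'v set"
  wva_init :: 'v
  wva_trans :: "'v \<Rightarrow> 'x \<Rightarrow> 'v"
  wva_final :: "'v \<Rightarrow> real"

definition is_wva :: "'x set \<Rightarrow> (real, 'v) module \<Rightarrow> ('v, 'x) wva \<Rightarrow> bool" where
  "is_wva X V A \<longleftrightarrow>
     vectorspace class_ring V \<and>
     wva_states A \<subseteq> carrier V \<and> wva_states A \<noteq> {} \<and>
     wva_init A \<in> wva_states A \<and>
     (\<forall>\<alpha>\<in>wva_states A. \<forall>x\<in>X. wva_trans A \<alpha> x \<in> wva_states A)"

definition wva_run :: "('v, 'x) wva \<Rightarrow> 'v \<Rightarrow> 'x list \<Rightarrow> 'v" where
  "wva_run A \<alpha> u = foldl (wva_trans A) \<alpha> u"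

definition wva_behavior :: "('v, 'x) wva \<Rightarrow> 'x list \<Rightarrow> real" where
  "wva_behavior A u = wva_final A (wva_run A (wva_init A) u)"

text \<open>The function generated by \<open>A\<close> with respect to the norm \<open>N\<close> on the underlying space.\<close>

definition wva_generated :: "('v \<Rightarrow> real) \<Rightarrow> ('v, 'x) wva \<Rightarrow> 'x list \<Rightarrow> real" where
  "wva_generated N A u = N (wva_run A (wva_init A) u)"

text \<open>The real line as a vector space over itself, the codomain of linear functionals.\<close>

definition real_line :: "(real, real) module" where
  "real_line =
     \<lparr>carrier = UNIV, mult = (*), one = 1, zero = 0, add = (+), smult = (*)\<rparr>"

lemma vectorspace_real_line: "vectorspace class_ring real_line"
  unfolding real_line_def
  by (rule vs_criteria[OF class_field])
    (auto simp: algebra_simps intro: exI[of _ "- x" for x])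

definition span_space :: "(real, 'v) module \<Rightarrow> 'v set \<Rightarrow> (real, 'v) module" where
  "span_space V S = V\<lparr>carrier := LinearCombinations.module.span class_ring V S\<rparr>"

definition is_linear_wva :: "'x set \<Rightarrow> (real, 'v) module \<Rightarrow> ('v, 'x) wva \<Rightarrow> bool" where
  "is_linear_wva X V A \<longleftrightarrow>
     is_wva X V A \<and>
     (\<forall>x\<in>X. \<exists>D. linear_map class_ring
                   (span_space V (wva_states A)) (span_space V (wva_states A)) D \<and>
                 (\<forall>\<alpha>\<in>wva_states A. wva_trans A \<alpha> x = D \<alpha>)) \<and>
     (\<exists>T. linear_map class_ring (span_space V (wva_states A)) real_line T \<and>
          (\<forall>\<alpha>\<in>wva_states A. wva_final A \<alpha> = T \<alpha>))"

text \<open>\<open>\<phi>\<close> is a linear isomorphism from \<open>V\<close> onto the space of real \<open>n\<close>-vectors, \<open>n \<ge> 1\<close>. The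
  finite-dimensional space \<open>V\<close> is identified with the latter along \<open>\<phi>\<close>, which
  gives the norm \<open>max_norm \<circ> \<phi>\<close> on \<open>V\<close>.\<close>

definition is_coordinate_iso :: "(real, 'v) module \<Rightarrow> nat \<Rightarrow> ('v \<Rightarrow> real vec) \<Rightarrow> bool" where
  "is_coordinate_iso V n \<phi> \<longleftrightarrow>
     n \<ge> 1 \<and>
     linear_map class_ring V (module_vec TYPE(real) n) \<phi> \<and>
     bij_betw \<phi> (carrier V) (carrier_vec n)"

end

theory Submission
  imports Defs
begin

text \<open>A linear automaton is transported to \<open>\<real>\<^sup>n\<close> along the coordinate isomorphism. The transition
  operators and the terminal functional are only defined on the span of the states, so they must be
  extended to all of \<open>\<real>\<^sup>n\<close>. This reduces to one fact: a functional that vanishes on the kernel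
  of a linear map \<open>\<phi>\<close> into \<open>\<real>\<^sup>n\<close> has the form \<open>u \<mapsto> a \<bullet> \<phi> u\<close>. Conversely, a finite automaton
  acts linearly on the whole space of row vectors.\<close>

section \<open>Linear maps between carrier-based spaces\<close>

lemma linear_mapI:
  assumes "vectorspace K V" "vectorspace K W" "f \<in> carrier V \<rightarrow> carrier W"
    and "\<And>u v. u \<in> carrier V \<Longrightarrow> v \<in> carrier V \<Longrightarrow> f (u \<oplus>\<^bsub>V\<^esub> v) = f u \<oplus>\<^bsub>W\<^esub> f v"
    and "\<And>c v. c \<in> carrier K \<Longrightarrow> v \<in> carrier V \<Longrightarrow> f (c \<odot>\<^bsub>V\<^esub> v) = c \<odot>\<^bsub>W\<^esub> f v"
  shows "linear_map K V W f"
  using assms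
  unfolding linear_map_def mod_hom_def mod_hom_axioms_def LinearCombinations.module_hom_def
    vectorspace_def
  by auto

lemma linear_map_comp:
  assumes "linear_map K U V f" "linear_map K V W g"
  shows "linear_map K U W (g \<circ> f)"
proof -
  interpret f: linear_map K U V f by fact
  interpret g: linear_map K V W g by fact
  show ?thesis
    by (rule linear_mapI) (auto simp: f.V.vectorspace_axioms g.W.vectorspace_axioms)
qed

text \<open>Brings the coordinate map down to the span of the states, the only space on which the
  transition operators and the terminal functional are given.\<close>

lemma linear_map_restrict:
  assumes "linear_map K V W f" "subspace K U V"
  shows "linear_map K (V\<lparr>carrier := U\<rparr>) W f"
proof -
  interpret linear_map K V W f by fact
  have U: "U \<subseteq> carrier V"
    using assms(2) by (auto simp: subspace_def LinearCombinations.submodule_def)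
  show ?thesis
    by (intro linear_mapI V.subspace_is_vs assms(2) W.vectorspace_axioms)
      (auto dest!: subsetD[OF U])
qed

section \<open>Factoring linear maps through coordinates\<close>

text \<open>By \<open>ker\<close>, \<open>f\<close> induces a functional on the image of
  \<open>\<phi>\<close>, and \<open>a\<close> extends it to all \<open>n\<close>-vectors. The vector
  \<open>a\<close> is built by induction on the number \<open>k\<close> of leading coordinates in
  which \<open>\<phi> u\<close> may be nonzero: for \<open>k = 0\<close> the claim is
  \<open>ker\<close>, and for \<open>k = n\<close> the restriction on \<open>u\<close> is
  void.\<close>

lemma functional_factors_through_coordinates:
  fixes U :: "(real, 'v) module"
  assumes \<phi>: "linear_map class_ring U (module_vec TYPE(real) n) \<phi>"
    and f: "linear_map class_ring U real_line f"
    and ker: "\<And>u. u \<in> carrier U \<Longrightarrow> \<phi> u = 0\<^sub>v n \<Longrightarrow> f u = 0"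
  obtains a where "a \<in> carrier_vec n" "\<And>u. u \<in> carrier U \<Longrightarrow> f u = a \<bullet> \<phi> u"
proof -
  interpret \<phi>: linear_map class_ring U "module_vec TYPE(real) n" \<phi> by fact
  interpret f: linear_map class_ring U real_line f by fact
  have \<phi>_carrier: "\<phi> u \<in> carrier_vec n" if "u \<in> carrier U" for u
    using \<phi>.f_im[OF that] by (simp add: module_vec_simps)
  (* In the step from k to k + 1, subtracting a multiple of a vector u1 with k-th coordinate 1
     kills the k-th coordinate, and the value of f at u1 determines the k-th entry of a. *)
  have "\<exists>a\<in>carrier_vec n. \<forall>u\<in>carrier U. (\<forall>i. k \<le> i \<and> i < n \<longrightarrow> \<phi> u $ i = 0) \<longrightarrow> f u = a \<bullet> \<phi> u"
    if "k \<le> n" for k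
    using that
  proof (induction k)
    case 0
    have "f u = 0\<^sub>v n \<bullet> \<phi> u" if "u \<in> carrier U" "\<forall>i<n. \<phi> u $ i = 0" for u
    proof -
      have "\<phi> u = 0\<^sub>v n"
        using that \<phi>_carrier[of u] by (intro eq_vecI) auto
      then show ?thesis
        using ker that by simp
    qed
    then show ?case
      by (intro bexI[of _ "0\<^sub>v n"]) auto
  next
    case (Suc k)
    let ?T = "{u \<in> carrier U. \<forall>i. Suc k \<le> i \<and> i < n \<longrightarrow> \<phi> u $ i = 0}"
    from Suc obtain a where a: "a \<in> carrier_vec n"
      and fa: "\<And>u. u \<in> carrier U \<Longrightarrow> (\<forall>i. k \<le> i \<and> i < n \<longrightarrow> \<phi> u $ i = 0) \<Longrightarrow> f u = a \<bullet> \<phi> u"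
      by auto
    show ?case
    proof (cases "\<exists>u\<in>?T. \<phi> u $ k \<noteq> 0")
      \<comment> \<open>Coordinate \<open>k\<close> vanishes on all of \<open>?T\<close>, so
        \<open>?T\<close> contains only vectors that the induction hypothesis already
        covers.\<close>
      case False
      then have "\<forall>u\<in>?T. \<forall>i. k \<le> i \<and> i < n \<longrightarrow> \<phi> u $ i = 0"
        by (metis (mono_tags, lifting) Suc_leI le_neq_implies_less mem_Collect_eq)
      then show ?thesis
        using a fa by blast
    next
      case True
      then obtain u0 where u0: "u0 \<in> ?T" "\<phi> u0 $ k \<noteq> 0" by blast
      define u1 where "u1 = inverse (\<phi> u0 $ k) \<odot>\<^bsub>U\<^esub> u0"
      have u1: "u1 \<in> carrier U" "\<phi> u1 $ k = 1"
        "\<And>i. Suc k \<le> i \<Longrightarrow> i < n \<Longrightarrow> \<phi> u1 $ i = 0"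
        using u0 Suc.prems \<phi>_carrier[of u0] by (auto simp: u1_def module_vec_simps)
      \<comment> \<open>The error of the old \<open>a\<close> at \<open>u1\<close>. Since coordinate
        \<open>k\<close> of \<open>\<phi> u1\<close> is 1, adding \<open>r\<close> to entry
        \<open>k\<close> of \<open>a\<close> cancels it, and vectors with coordinate
        \<open>k\<close> equal to 0 do not notice the change.\<close>
      define r where "r = f u1 - a \<bullet> \<phi> u1"
      have "f u = (a + r \<cdot>\<^sub>v unit_vec n k) \<bullet> \<phi> u" if u: "u \<in> ?T" for u
      proof -
        define w where "w = u \<oplus>\<^bsub>U\<^esub> (- (\<phi> u $ k)) \<odot>\<^bsub>U\<^esub> u1"
        note carr = \<phi>_carrier[of u] \<phi>_carrier[of u1]
        have \<phi>w: "\<phi> w = \<phi> u + (- (\<phi> u $ k)) \<cdot>\<^sub>v \<phi> u1"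
          using u u1 by (simp add: w_def module_vec_simps)
        have "\<phi> w $ i = 0" if "k \<le> i" "i < n" for i
          using that u u1 carr by (cases "i = k") (auto simp: \<phi>w)
        then have "f w = a \<bullet> \<phi> w"
          using u u1 by (intro fa) (auto simp: w_def)
        also have "\<dots> = a \<bullet> \<phi> u - \<phi> u $ k * (a \<bullet> \<phi> u1)"
          using u u1 a carr by (auto simp: \<phi>w scalar_prod_add_distrib[of _ n])
        finally have "f u = a \<bullet> \<phi> u + r * \<phi> u $ k"
          using u u1 by (simp add: w_def real_line_def r_def algebra_simps)
        also have "\<dots> = (a + r \<cdot>\<^sub>v unit_vec n k) \<bullet> \<phi> u"
          using u a carr Suc.prems
          by (auto simp: add_scalar_prod_distrib[of _ n] scalar_prod_left_unit)
        finally show ?thesis .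
      qed
      then show ?thesis
        using a by (intro bexI[of _ "a + r \<cdot>\<^sub>v unit_vec n k"]) auto
    qed
  qed
  from this[of n] that show thesis by auto
qed

text \<open>Each coordinate of \<open>g\<close> is a functional vanishing on the kernel of
  \<open>\<phi>\<close>; the vectors representing these functionals are the rows of
  \<open>M\<close>.\<close>

lemma linear_map_factors_through_coordinates:
  fixes U :: "(real, 'v) module"
  assumes \<phi>: "linear_map class_ring U (module_vec TYPE(real) n) \<phi>"
    and g: "linear_map class_ring U (module_vec TYPE(real) m) g"
    and ker: "\<And>u. u \<in> carrier U \<Longrightarrow> \<phi> u = 0\<^sub>v n \<Longrightarrow> g u = 0\<^sub>v m"
  obtains M where "M \<in> carrier_mat m n" "\<And>u. u \<in> carrier U \<Longrightarrow> g u = M *\<^sub>v \<phi> u"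
proof -
  interpret g: linear_map class_ring U "module_vec TYPE(real) m" g by fact
  have g_carrier: "g u \<in> carrier_vec m" if "u \<in> carrier U" for u
    using g.f_im[OF that] by (simp add: module_vec_simps)
  have "\<exists>a. a \<in> carrier_vec n \<and> (\<forall>u\<in>carrier U. g u $ i = a \<bullet> \<phi> u)" if i: "i < m" for i
  proof -
    have "linear_map class_ring U real_line (\<lambda>u. g u $ i)"
      using i g_carrier
      by (intro linear_mapI g.V.vectorspace_axioms vectorspace_real_line)
        (auto simp: real_line_def module_vec_simps carrier_vecD[OF g_carrier])
    from functional_factors_through_coordinates[OF \<phi> this] ker i show ?thesis
      by (metis index_zero_vec(1))
  qed
  then obtain a where a: "\<And>i. i < m \<Longrightarrow> a i \<in> carrier_vec n"
    and ga: "\<And>i u. i < m \<Longrightarrow> u \<in> carrier U \<Longrightarrow> g u $ i = a i \<bullet> \<phi> u"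
    by metis
  have "g u = mat_of_rows n (map a [0..<m]) *\<^sub>v \<phi> u" if u: "u \<in> carrier U" for u
    using g_carrier[OF u] a ga[OF _ u] by (intro eq_vecI) simp_all
  moreover have "mat_of_rows n (map a [0..<m]) \<in> carrier_mat m n"
    using mat_of_rows_carrier(1)[of n "map a [0..<m]"] by simp
  ultimately show thesis
    using that by blast
qed

section \<open>Words acting in a finite automaton\<close>

lemma wfa_mat_carrier:
  assumes "is_wfa X A" "u \<in> lists X"
  shows "wfa_mat A u \<in> carrier_mat (wfa_dim A) (wfa_dim A)"
  using assms(2,1) by induction (auto simp: wfa_mat_def is_wfa_def)

text \<open>The \<open>foldr\<close> in \<open>wfa_mat\<close> peels off the first letter, whereas
  runs grow at the last one. Associativity of the matrix product mediates between the two.\<close>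

lemma wfa_mat_snoc:
  assumes A: "is_wfa X A" and "u \<in> lists X" and x: "x \<in> X"
  shows "wfa_mat A (u @ [x]) = wfa_mat A u * wfa_trans A x"
  using assms(2)
proof induction
  case Nil
  then show ?case
    using A x by (auto simp: wfa_mat_def is_wfa_def)
next
  case (Cons y u)
  have "wfa_mat A ((y # u) @ [x]) = wfa_trans A y * (wfa_mat A u * wfa_trans A x)"
    using Cons by (simp add: wfa_mat_def)
  also have "\<dots> = (wfa_trans A y * wfa_mat A u) * wfa_trans A x"
    using A x Cons wfa_mat_carrier[OF A, of u]
    by (intro assoc_mult_mat[symmetric]) (auto simp: is_wfa_def)
  finally show ?case
    by (simp add: wfa_mat_def)
qed

lemma wfa_vec_Nil:
  assumes "is_wfa X A"
  shows "wfa_vec A [] = wfa_init A"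
proof -
  have "wfa_init A \<in> carrier_vec (wfa_dim A)"
    using assms by (simp add: is_wfa_def)
  then have "mat_of_row (wfa_init A) * 1\<^sub>m (wfa_dim A) = mat_of_row (wfa_init A)"
    by (intro right_mult_one_mat) auto
  then show ?thesis
    by (auto simp: wfa_vec_def wfa_mat_def intro!: eq_vecI)
qed

text \<open>Transposing turns the action on row vectors from the right into a matrix-vector product,
  the form in which linear operators appear on the other side of the equivalence.\<close>

lemma wfa_vec_snoc:
  assumes A: "is_wfa X A" and u: "u \<in> lists X" and x: "x \<in> X"
  shows "wfa_vec A (u @ [x]) = transpose_mat (wfa_trans A x) *\<^sub>v wfa_vec A u"
proof -
  let ?n = "wfa_dim A"
  have P: "mat_of_row (wfa_init A) * wfa_mat A u \<in> carrier_mat 1 ?n"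
    and \<sigma>: "mat_of_row (wfa_init A) \<in> carrier_mat 1 ?n"
    and M: "wfa_trans A x \<in> carrier_mat ?n ?n"
    using A x wfa_mat_carrier[OF A u] by (auto simp: is_wfa_def)
  have v: "wfa_vec A u \<in> carrier_vec ?n"
    using carrier_matD(2)[OF P] unfolding wfa_vec_def by (metis row_carrier)
  have "wfa_vec A (u @ [x]) = row (mat_of_row (wfa_init A) * wfa_mat A u * wfa_trans A x) 0"
    using assoc_mult_mat[OF \<sigma> wfa_mat_carrier[OF A u] M]
    by (simp add: wfa_vec_def wfa_mat_snoc[OF A u x])
  also have "\<dots> = vec ?n (\<lambda>j. wfa_vec A u \<bullet> col (wfa_trans A x) j)"
    using row_mult[OF P M, of 0] by (simp add: wfa_vec_def)
  also have "\<dots> = transpose_mat (wfa_trans A x) *\<^sub>v wfa_vec A u"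
    using M v by (intro eq_vecI) (auto intro!: comm_scalar_prod[of _ ?n])
  finally show ?thesis .
qed

section \<open>Runs of automata over a vector space\<close>

lemma wva_run_snoc: "wva_run A \<alpha> (u @ [x]) = wva_trans A (wva_run A \<alpha> u) x"
  by (simp add: wva_run_def)

lemma wva_run_in_states:
  assumes "is_wva X V A" "u \<in> lists X"
  shows "wva_run A (wva_init A) u \<in> wva_states A"
  using assms(2)
proof (induction u rule: rev_induct)
  case Nil
  then show ?case
    using assms(1) by (simp add: wva_run_def is_wva_def)
next
  case (snoc x u)
  then show ?case
    using assms(1) by (simp add: wva_run_snoc is_wva_def)
qed

section \<open>From linear automata to finite automata\<close>

text \<open>The invariant is that after each word the vector of \<open>A'\<close> is the
  \<open>\<phi>\<close>-image of the state reached by \<open>A\<close>. Equality of the generated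
  functions is then immediate, because the norm on \<open>V\<close> is pulled back along
  \<open>\<phi>\<close>.\<close>

lemma wva_imp_wfa:
  fixes X :: "'x set" and V :: "(real, 'v) module"
  assumes iso: "is_coordinate_iso V n \<phi>" and lin: "is_linear_wva X V A"
  shows "\<exists>A' :: 'x wfa. is_wfa X A' \<and>
           (\<forall>u\<in>lists X. wfa_behavior A' u = wva_behavior A u \<and>
                        wfa_generated A' u = wva_generated (max_norm \<circ> \<phi>) A u)"
proof -
  let ?S = "wva_states A"
  let ?U = "span_space V ?S"
  have \<phi>: "linear_map class_ring V (module_vec TYPE(real) n) \<phi>"
    using iso by (simp add: is_coordinate_iso_def)
  interpret V: vectorspace class_ring V
    using \<phi> by (rule linear_map.axioms)
  interpret \<phi>: linear_map class_ring V "module_vec TYPE(real) n" \<phi>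
    by (rule \<phi>)
  have n: "n \<ge> 1" and bij: "bij_betw \<phi> (carrier V) (carrier_vec n)"
    using iso by (auto simp: is_coordinate_iso_def)
  have wva: "is_wva X V A"
    using lin by (simp add: is_linear_wva_def)
  then have S: "?S \<subseteq> carrier V" "wva_init A \<in> ?S"
    by (auto simp: is_wva_def)
  have U: "carrier ?U \<subseteq> carrier V" and SU: "?S \<subseteq> carrier ?U"
    using V.span_is_subset2[OF S(1)] V.in_own_span[OF S(1)] by (auto simp: span_space_def)
  have \<phi>U: "linear_map class_ring ?U (module_vec TYPE(real) n) \<phi>"
    unfolding span_space_def
    by (intro linear_map_restrict \<phi> V.span_is_subspace S)
  have \<phi>_carrier: "\<phi> v \<in> carrier_vec n" if "v \<in> carrier V" for v
    using bij that by (auto simp: bij_betw_def)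
  \<comment> \<open>Injectivity of \<open>\<phi>\<close> leaves only the zero vector in its kernel.
    The codomain \<open>W\<close> is kept general to serve both the operators and the terminal
    functional.\<close>
  have ker: "g u = \<zero>\<^bsub>W\<^esub>"
    if g: "linear_map class_ring ?U W g" and u: "u \<in> carrier ?U" "\<phi> u = 0\<^sub>v n" for W g u
  proof -
    interpret g: linear_map class_ring ?U W g by fact
    have "\<phi> \<zero>\<^bsub>V\<^esub> = 0\<^sub>v n"
      using \<phi>.f0_is_0 by (simp add: module_vec_simps)
    then have "u = \<zero>\<^bsub>V\<^esub>"
      using u U bij by (metis V.M.zero_closed bij_betw_imp_inj_on inj_onD subsetD)
    moreover have "\<zero>\<^bsub>V\<^esub> = \<zero>\<^bsub>?U\<^esub>"
      by (simp add: span_space_def)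
    ultimately show ?thesis
      using g.f0_is_0 by simp
  qed
  have "\<exists>M. M \<in> carrier_mat n n \<and> (\<forall>\<alpha>\<in>?S. \<phi> (wva_trans A \<alpha> x) = M *\<^sub>v \<phi> \<alpha>)" if "x \<in> X" for x
  proof -
    obtain D where D: "linear_map class_ring ?U ?U D" "\<And>\<alpha>. \<alpha> \<in> ?S \<Longrightarrow> wva_trans A \<alpha> x = D \<alpha>"
      using lin \<open>x \<in> X\<close> unfolding is_linear_wva_def by blast
    \<comment> \<open>Factoring \<open>\<phi> \<circ> D\<close> through \<open>\<phi>\<close> yields
      a matrix that acts on all \<open>n\<close>-vectors and agrees with \<open>D\<close> on the
      coordinates of the span.\<close>
    have \<phi>D: "linear_map class_ring ?U (module_vec TYPE(real) n) (\<phi> \<circ> D)"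
      by (rule linear_map_comp[OF D(1) \<phi>U])
    obtain M where "M \<in> carrier_mat n n" "\<And>u. u \<in> carrier ?U \<Longrightarrow> (\<phi> \<circ> D) u = M *\<^sub>v \<phi> u"
      by (rule linear_map_factors_through_coordinates[OF \<phi>U \<phi>D])
        (use ker[OF \<phi>D] in \<open>auto simp: module_vec_simps\<close>)
    then show ?thesis
      using SU D(2) by (intro exI[of _ M]) auto
  qed
  then obtain M where M: "\<And>x. x \<in> X \<Longrightarrow> M x \<in> carrier_mat n n"
    and \<phi>M: "\<And>x \<alpha>. x \<in> X \<Longrightarrow> \<alpha> \<in> ?S \<Longrightarrow> \<phi> (wva_trans A \<alpha> x) = M x *\<^sub>v \<phi> \<alpha>"
    by metis
  obtain T where T: "linear_map class_ring ?U real_line T"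
    "\<And>\<alpha>. \<alpha> \<in> ?S \<Longrightarrow> wva_final A \<alpha> = T \<alpha>"
    using lin unfolding is_linear_wva_def by blast
  obtain \<tau> where \<tau>: "\<tau> \<in> carrier_vec n" "\<And>u. u \<in> carrier ?U \<Longrightarrow> T u = \<tau> \<bullet> \<phi> u"
    by (rule functional_factors_through_coordinates[OF \<phi>U T(1)])
      (use ker[OF T(1)] in \<open>auto simp: real_line_def\<close>)
  \<comment> \<open>The matrices \<open>M x\<close> act on columns, while a finite automaton
    multiplies rows from the right; hence the transposes.\<close>
  define A' :: "'x wfa" where "A' = \<lparr>wfa_dim = n, wfa_init = \<phi> (wva_init A),
    wfa_trans = (\<lambda>x. transpose_mat (M x)), wfa_final = \<tau>\<rparr>"
  have A': "is_wfa X A'"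
    using n M \<tau> S \<phi>_carrier by (auto simp: is_wfa_def A'_def)
  have run: "wfa_vec A' u = \<phi> (wva_run A (wva_init A) u)" if "u \<in> lists X" for u
    using that
  proof (induction u rule: rev_induct)
    case Nil
    then show ?case
      using wfa_vec_Nil[OF A'] by (simp add: A'_def wva_run_def)
  next
    case (snoc x u)
    then have u: "u \<in> lists X" "x \<in> X" by auto
    have "wfa_vec A' (u @ [x]) = M x *\<^sub>v wfa_vec A' u"
      by (simp add: wfa_vec_snoc[OF A' u]) (simp add: A'_def)
    then show ?case
      using snoc u \<phi>M wva_run_in_states[OF wva u(1)] by (simp add: wva_run_snoc)
  qed
  have "wfa_behavior A' u = wva_behavior A u \<and>
      wfa_generated A' u = wva_generated (max_norm \<circ> \<phi>) A u" if u: "u \<in> lists X" for u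
  proof -
    let ?\<alpha> = "wva_run A (wva_init A) u"
    have \<alpha>: "?\<alpha> \<in> ?S"
      by (rule wva_run_in_states[OF wva u])
    have "\<phi> ?\<alpha> \<bullet> \<tau> = \<tau> \<bullet> \<phi> ?\<alpha>"
      using \<alpha> S \<tau>(1) \<phi>_carrier by (intro comm_scalar_prod) auto
    also have "\<dots> = wva_final A ?\<alpha>"
      using \<alpha> SU \<tau>(2) T(2) by auto
    finally show ?thesis
      using run[OF u]
      by (simp add: wfa_behavior_def wva_behavior_def wfa_generated_def wva_generated_def)
        (simp add: A'_def)
  qed
  with A' show ?thesis by blast
qed

section \<open>From finite automata to linear automata\<close>

text \<open>Taking every \<open>n\<close>-vector as a state makes the transitions linear operators
  on the whole space, and the identity serves as coordinate isomorphism.\<close>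

lemma wfa_imp_wva:
  fixes X :: "'x set" and A :: "'x wfa"
  assumes A: "is_wfa X A"
  shows "\<exists>(V :: (real, real vec) module) n \<phi> (B :: (real vec, 'x) wva).
           is_coordinate_iso V n \<phi> \<and> is_linear_wva X V B \<and>
           (\<forall>u\<in>lists X. wva_behavior B u = wfa_behavior A u \<and>
                        wva_generated (max_norm \<circ> \<phi>) B u = wfa_generated A u)"
proof -
  define n where "n = wfa_dim A"
  let ?V = "module_vec TYPE(real) n"
  interpret V: vectorspace class_ring ?V by (rule vec_vs)
  define B :: "(real vec, 'x) wva" where "B = \<lparr>wva_states = carrier_vec n,
    wva_init = wfa_init A, wva_trans = (\<lambda>\<alpha> x. transpose_mat (wfa_trans A x) *\<^sub>v \<alpha>),
    wva_final = (\<lambda>\<alpha>. \<alpha> \<bullet> wfa_final A)\<rparr>"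
  have n: "n \<ge> 1" and \<sigma>: "wfa_init A \<in> carrier_vec n" and \<tau>: "wfa_final A \<in> carrier_vec n"
    and M: "\<And>x. x \<in> X \<Longrightarrow> wfa_trans A x \<in> carrier_mat n n"
    using A by (auto simp: is_wfa_def n_def)
  have iso: "is_coordinate_iso ?V n id"
    using n by (auto simp: is_coordinate_iso_def module_vec_simps intro!: linear_mapI vec_vs)
  have wva: "is_wva X ?V B"
    using \<sigma> M
    by (auto simp: is_wva_def B_def module_vec_simps vec_vs intro!: mult_mat_vec_carrier)
  \<comment> \<open>The states already fill the space, so \<open>span_space\<close> returns
    \<open>?V\<close> itself and linearity need only be checked there.\<close>
  have "LinearCombinations.module.span class_ring ?V (carrier ?V) = carrier ?V"
    using V.span_is_subset2[of "carrier ?V"] V.in_own_span[of "carrier ?V"] by auto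
  then have span: "span_space ?V (wva_states B) = ?V"
    by (simp add: span_space_def B_def module_vec_simps)
  have trans: "linear_map class_ring ?V ?V (\<lambda>\<alpha>. transpose_mat (wfa_trans A x) *\<^sub>v \<alpha>)"
    if "x \<in> X" for x
    using M[OF that]
    by (intro linear_mapI vec_vs)
      (auto simp: module_vec_simps mult_add_distrib_mat_vec[of _ n n] mult_mat_vec[of _ n n]
        intro!: mult_mat_vec_carrier)
  have final: "linear_map class_ring ?V real_line (\<lambda>\<alpha>. \<alpha> \<bullet> wfa_final A)"
    using \<tau> by (intro linear_mapI vec_vs vectorspace_real_line)
      (auto simp: real_line_def module_vec_simps add_scalar_prod_distrib[of _ n])
  have lin: "is_linear_wva X ?V B"
    unfolding is_linear_wva_def span using wva trans final by (auto simp: B_def)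
  have run: "wva_run B (wva_init B) u = wfa_vec A u" if "u \<in> lists X" for u
    using that
  proof (induction u rule: rev_induct)
    case Nil
    then show ?case
      by (simp add: wva_run_def wfa_vec_Nil[OF A] B_def)
  next
    case (snoc x u)
    then have "wva_run B (wva_init B) u = wfa_vec A u" "u \<in> lists X" "x \<in> X"
      by auto
    then show ?case
      by (simp add: wva_run_snoc wfa_vec_snoc[OF A]) (simp add: B_def)
  qed
  have "wva_behavior B u = wfa_behavior A u \<and>
      wva_generated (max_norm \<circ> id) B u = wfa_generated A u" if "u \<in> lists X" for u
    using run[OF that]
    by (simp add: wfa_behavior_def wva_behavior_def wfa_generated_def wva_generated_def)
      (simp add: B_def)
  with iso lin show ?thesis by blast
qed

text \<open>An existential quantifier cannot range over types, so the second half fixes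
  \<open>real vec\<close>, a single type whose carriers include the real \<open>n\<close>-vectors
  for every \<open>n\<close>; in the first half \<open>'v\<close> is arbitrary.\<close>

theorem theorem4p2:
  fixes X :: "'x set"
  shows
    "(\<forall>(V :: (real, 'v) module) n \<phi> (A :: ('v, 'x) wva).
        is_coordinate_iso V n \<phi> \<and> is_linear_wva X V A \<longrightarrow>
        (\<exists>A' :: 'x wfa. is_wfa X A' \<and>
           (\<forall>u\<in>lists X. wfa_behavior A' u = wva_behavior A u \<and>
                        wfa_generated A' u = wva_generated (max_norm \<circ> \<phi>) A u)))
     \<and>
     (\<forall>A :: 'x wfa. is_wfa X A \<longrightarrow>
        (\<exists>(V :: (real, real vec) module) n \<phi> (B :: (real vec, 'x) wva).
           is_coordinate_iso V n \<phi> \<and> is_linear_wva X V B \<and>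
           (\<forall>u\<in>lists X. wva_behavior B u = wfa_behavior A u \<and>
                        wva_generated (max_norm \<circ> \<phi>) B u = wfa_generated A u)))"
  using wva_imp_wfa wfa_imp_wva by blast

end
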